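(* Let $K\subseteq\mathbb{R}^n$ ($n\ge2$) be convex, and let $p_1,p_2,p_3\in K$ be non-collinear; put $A=\operatorname{aff}\{p_1,p_2,p_3\}$, a two-dimensional affine subspace. Then: (i) $K\cap A=\{z\in K: K\models\operatorname{Dep}_4(p_1,p_2,p_3,z)\}$; in particular the section $K\cap A$ is definable with parameters $p_1,p_2,p_3$. (ii) $K\cap A$ is convex, closed under every operation $C_\lambda$ ($\lambda\in[0,1]$), has nonempty relative interior, and is compact whenever $K$ is. Via any affine identification $A\cong\mathbb{R}^2$ it is a planar convex set with nonempty interior, and the identification is an isomorphism for both languages $\mathcal{L}_{\mathrm{B}}$ and $\mathcal{L}_{\mathrm{aff}}$. (iii) For every $\mathcal{L}_{\mathrm{B}}$-formula (respectively $\mathcal{L}_{\mathrm{aff}}$-formula) $\varphi(\bar x)$ there is a formula $\varphi^{\circ}(\bar x;p_1,p_2,p_3)$ of the same language such that for all tuples $\bar a$ from $K\cap A$, $$K\models\varphi^{\circ}(\bar a;p_1,p_2,p_3)\iff (K\cap A)\models\varphi(\bar a).$$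
   Context: $\mathcal{L}_{\mathrm{B}}$ is the first-order language with a single ternary relation symbol $B$; $\mathcal{L}_{\mathrm{aff}}$ adds one binary function symbol $C_\lambda$ for each real $\lambda\in[0,1]$. A convex set $K$ is a structure with universe $K$ for both languages: $C_\lambda(p,q)=(1-\lambda)p+\lambda q$, and $B(a,x,b)$ holds iff $x\in[a,b]$. Convex sets such as $K\cap A$ are likewise regarded as structures. $H_1(z;x_1):\equiv z=x_1$ and $H_r(z;x_1,\dots,x_r):\equiv\exists w\,(H_{r-1}(w;x_2,\dots,x_r)\wedge B(x_1,z,w))$. For $m\ge2$, $$\operatorname{Dep}_m(x_1,\dots,x_m):\equiv\bigvee_{\{1,\dots,m\}=I\sqcup J,\ I,J\neq\emptyset}\exists z\,\bigl(H_{|I|}(z;\bar x_I)\wedge H_{|J|}(z;\bar x_J)\bigr).$$ *)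

theory Defs
  imports "HOL-Analysis.Analysis"
begin

text \<open>
  Both languages are carved out of one syntax: a language is given by the set of labels
  \<open>\<lambda>\<close> whose function symbol \<open>C\<^sub>\<lambda>\<close> it contains.
  Variables are de Bruijn indices into an environment list; a quantifier
  pushes its witness onto the front of that list.  A formula in the free variables
  \<open>x\<^sub>0, \<dots>, x\<^sub>k\<^sub>-\<^sub>1\<close> is evaluated in an environment of length \<open>k\<close>.
\<close>

datatype (labels_trm: 'l) trm =
    Var nat
  | Comb 'l "'l trm" "'l trm"

datatype (labels: 'l) fm =
    Fls
  | Eq "'l trm" "'l trm"
  | Btw "'l trm" "'l trm" "'l trm"
  | Neg "'l fm"
  | Con "'l fm" "'l fm"
  | Dis "'l fm" "'l fm"
  | Imp "'l fm" "'l fm"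
  | Ex "'l fm"
  | All "'l fm"

definition L_B :: "real set" where "L_B = {}"

definition L_aff :: "real set" where "L_aff = {0..1}"

definition formulas :: "'l set \<Rightarrow> 'l fm set" where
  "formulas L = {\<phi>. labels \<phi> \<subseteq> L}"

primrec fv_trm :: "'l trm \<Rightarrow> nat set" where
  "fv_trm (Var n) = {n}"
| "fv_trm (Comb l s t) = fv_trm s \<union> fv_trm t"

primrec fv :: "'l fm \<Rightarrow> nat set" where
  "fv Fls = {}"
| "fv (Eq s t) = fv_trm s \<union> fv_trm t"
| "fv (Btw s t u) = fv_trm s \<union> fv_trm t \<union> fv_trm u"
| "fv (Neg \<phi>) = fv \<phi>"
| "fv (Con \<phi> \<psi>) = fv \<phi> \<union> fv \<psi>"
| "fv (Dis \<phi> \<psi>) = fv \<phi> \<union> fv \<psi>"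
| "fv (Imp \<phi> \<psi>) = fv \<phi> \<union> fv \<psi>"
| "fv (Ex \<phi>) = {n. Suc n \<in> fv \<phi>}"
| "fv (All \<phi>) = {n. Suc n \<in> fv \<phi>}"

record ('l, 'a) struct =
  univ :: "'a set"
  btw :: "'a \<Rightarrow> 'a \<Rightarrow> 'a \<Rightarrow> bool"
  comb :: "'l \<Rightarrow> 'a \<Rightarrow> 'a \<Rightarrow> 'a"

primrec eval_trm :: "('l, 'a) struct \<Rightarrow> 'a list \<Rightarrow> 'l trm \<Rightarrow> 'a" where
  "eval_trm M e (Var n) = e ! n"
| "eval_trm M e (Comb l s t) = comb M l (eval_trm M e s) (eval_trm M e t)"

primrec sat :: "('l, 'a) struct \<Rightarrow> 'a list \<Rightarrow> 'l fm \<Rightarrow> bool" where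
  "sat M e Fls \<longleftrightarrow> False"
| "sat M e (Eq s t) \<longleftrightarrow> eval_trm M e s = eval_trm M e t"
| "sat M e (Btw s t u) \<longleftrightarrow> btw M (eval_trm M e s) (eval_trm M e t) (eval_trm M e u)"
| "sat M e (Neg \<phi>) \<longleftrightarrow> \<not> sat M e \<phi>"
| "sat M e (Con \<phi> \<psi>) \<longleftrightarrow> sat M e \<phi> \<and> sat M e \<psi>"
| "sat M e (Dis \<phi> \<psi>) \<longleftrightarrow> sat M e \<phi> \<or> sat M e \<psi>"
| "sat M e (Imp \<phi> \<psi>) \<longleftrightarrow> (sat M e \<phi> \<longrightarrow> sat M e \<psi>)"
| "sat M e (Ex \<phi>) \<longleftrightarrow> (\<exists>a \<in> univ M. sat M (a # e) \<phi>)"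
| "sat M e (All \<phi>) \<longleftrightarrow> (\<forall>a \<in> univ M. sat M (a # e) \<phi>)"

text \<open>In \<open>btw M a x b\<close> the middle argument is the point lying between the other two.\<close>

definition convex_struct :: "'a::real_vector set \<Rightarrow> (real, 'a) struct" where
  "convex_struct K =
     \<lparr> univ = K,
       btw = (\<lambda>a x b. x \<in> closed_segment a b),
       comb = (\<lambda>l p q. (1 - l) *\<^sub>R p + l *\<^sub>R q) \<rparr>"

definition struct_iso ::
  "'l set \<Rightarrow> ('l, 'a) struct \<Rightarrow> ('l, 'b) struct \<Rightarrow> ('a \<Rightarrow> 'b) \<Rightarrow> bool" where
  "struct_iso L M N f \<longleftrightarrow>
     bij_betw f (univ M) (univ N) \<and>
     (\<forall>a \<in> univ M. \<forall>x \<in> univ M. \<forall>b \<in> univ M. btw M a x b \<longleftrightarrow> btw N (f a) (f x) (f b)) \<and>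
     (\<forall>l \<in> L. \<forall>a \<in> univ M. \<forall>b \<in> univ M. f (comb M l a b) = comb N l (f a) (f b))"

definition definable_with_params ::
  "'l set \<Rightarrow> ('l, 'a) struct \<Rightarrow> 'a list \<Rightarrow> 'a set \<Rightarrow> bool" where
  "definable_with_params L M ps S \<longleftrightarrow>
     set ps \<subseteq> univ M \<and>
     (\<exists>\<phi> \<in> formulas L. fv \<phi> \<subseteq> {..<length ps + 1} \<and> S = {z \<in> univ M. sat M (ps @ [z]) \<phi>})"

text \<open>Index shift that protects the variables of a term placed under one more quantifier.\<close>

primrec lift_trm :: "'l trm \<Rightarrow> 'l trm" where
  "lift_trm (Var n) = Var (Suc n)"
| "lift_trm (Comb l s t) = Comb l (lift_trm s) (lift_trm t)"

text \<open>
  \<open>H z [x\<^sub>1, \<dots>, x\<^sub>r]\<close> is the formula \<open>H\<^sub>r(z; x\<^sub>1, \<dots>, x\<^sub>r)\<close>.  It is meant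
  for \<open>r \<ge> 1\<close> only and unspecified on the empty list.
\<close>

fun H :: "'l trm \<Rightarrow> 'l trm list \<Rightarrow> 'l fm" where
  "H z [x] = Eq z x"
| "H z (x # y # xs) =
     Ex (Con (H (Var 0) (map lift_trm (y # xs))) (Btw (lift_trm x) (lift_trm z) (Var 0)))"

text \<open>
  \<open>Dep [x\<^sub>1, \<dots>, x\<^sub>m]\<close> is the formula \<open>Dep\<^sub>m(x\<^sub>1, \<dots>, x\<^sub>m)\<close>.  The disjunction runs
  over the ordered pairs \<open>(I, J)\<close> with \<open>J\<close> the complement of \<open>I\<close>; positions are counted from 0,
  and \<open>nths xs I\<close> is the subtuple of \<open>xs\<close> with positions in \<open>I\<close>, in increasing order.
\<close>

definition Dep :: "'l trm list \<Rightarrow> 'l fm" where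
  "Dep xs = (let m = length xs in
     foldr Dis
       [Ex (Con (H (Var 0) (map lift_trm (nths xs I)))
                (H (Var 0) (map lift_trm (nths xs ({..<m} - I))))).
         I \<leftarrow> map set (subseqs [0..<m]), I \<noteq> {}, {..<m} - I \<noteq> {}]
       Fls)"

definition affine_identification ::
  "'a::real_vector set \<Rightarrow> ('a \<Rightarrow> 'b::real_vector) \<Rightarrow> bool" where
  "affine_identification A f \<longleftrightarrow>
     bij_betw f A UNIV \<and>
     (\<forall>x \<in> A. \<forall>y \<in> A. \<forall>t. f ((1 - t) *\<^sub>R x + t *\<^sub>R y) = (1 - t) *\<^sub>R f x + t *\<^sub>R f y)"

end

theory Submission
  imports Defs
begin

text \<open>
  The formula \<open>H\<^sub>r\<close> says that \<open>z\<close> lies in the convex hull of the \<open>x\<^sub>i\<close>, so \<open>Dep\<^sub>m\<close> says that the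
  family admits a Radon partition; by Radon's theorem this is affine dependence of the family,
  repetitions counting as dependence.  For three affinely independent points and a fourth point
  \<open>z\<close> this is \<open>z \<in> A\<close>.  Hence \<open>K \<inter> A\<close> is a definable substructure, closed under the function
  symbols, and formulas are transferred by relativising the quantifiers to \<open>Dep\<^sub>4\<close>.
\<close>

section \<open>Affine dependence and the formulas \<open>H\<close> and \<open>Dep\<close>\<close>

text \<open>Disjoint parts of an independent family have disjoint affine hulls, hence disjoint
  convex hulls. Conversely, a repeated point goes on both sides, and for distinct points Radon's
  theorem applies. Empty blocks do no harm, as their hull is empty.\<close>

lemma radon_list:
  fixes ps :: "'a::euclidean_space list"
  defines "m \<equiv> length ps"
  shows "(\<exists>I\<subseteq>{..<m}. convex hull set (nths ps I) \<inter> convex hull set (nths ps ({..<m} - I)) \<noteq> {})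
    \<longleftrightarrow> \<not> (distinct ps \<and> \<not> affine_dependent (set ps))" (is "?L \<longleftrightarrow> ?R")
proof
  assume ?L
  then obtain I where I: "I \<subseteq> {..<m}"
    and ne: "convex hull set (nths ps I) \<inter> convex hull set (nths ps ({..<m} - I)) \<noteq> {}"
    by blast
  show ?R
  proof
    assume *: "distinct ps \<and> \<not> affine_dependent (set ps)"
    then have "set (nths ps I) \<inter> set (nths ps ({..<m} - I)) = {}"
      by (auto simp: set_nths nth_eq_iff_index_eq)
    then have "affine hull set (nths ps I) \<inter> affine hull set (nths ps ({..<m} - I)) = {}"
      using * by (intro disjoint_affine_hull[of "set ps"]) (auto dest: in_set_nthsD)
    then show False
      using ne convex_hull_subset_affine_hull by blast
  qed
next
  assume R: ?R
  show ?L
  proof (cases "distinct ps")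
    case False
    then obtain i j where ij: "i < m" "j < m" "i \<noteq> j" "ps ! i = ps ! j"
      by (auto simp: distinct_conv_nth m_def)
    have "ps ! i \<in> set (nths ps {i})"
      using ij by (auto simp: set_nths m_def)
    moreover have "ps ! i \<in> set (nths ps ({..<m} - {i}))"
      using ij by (force simp: set_nths m_def)
    ultimately have "ps ! i \<in> convex hull set (nths ps {i}) \<inter> convex hull set (nths ps ({..<m} - {i}))"
      by (simp add: hull_inc)
    then show ?thesis
      using ij by (intro exI[of _ "{i}"]) auto
  next
    case True
    then have "affine_dependent (set ps)"
      using R by simp
    then obtain M P where MP: "M \<inter> P = {}" "M \<union> P = set ps" "convex hull M \<inter> convex hull P \<noteq> {}"
      using Radon_partition[OF List.finite_set] by metis
    \<comment> \<open>Radon's theorem splits the set of points; \<open>I\<close> collects the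
      positions of one half. As the halves are disjoint and cover the list, the other positions give
      \<open>P\<close>.\<close>
    define I where "I = {i. i < m \<and> ps ! i \<in> M}"
    have "set (nths ps I) = M"
      using MP by (auto simp: set_nths I_def m_def) (metis UnI1 in_set_conv_nth)
    moreover have "set (nths ps ({..<m} - I)) = P"
    proof
      show "set (nths ps ({..<m} - I)) \<subseteq> P"
        using MP by (auto simp: set_nths I_def m_def)
      show "P \<subseteq> set (nths ps ({..<m} - I))"
        using MP by (auto simp: set_nths I_def m_def) (metis IntI UnI2 empty_iff in_set_conv_nth)
    qed
    ultimately show ?thesis
      using MP by (intro exI[of _ I]) (auto simp: I_def)
  qed
qed

text \<open>A point outside the hull raises affine dimension and cardinality by one each, so
  independence persists. A point inside leaves the dimension unchanged, so it is a repetition or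
  creates a dependence.\<close>

lemma distinct_affine_independent_insert_iff:
  fixes z :: "'a::euclidean_space"
  assumes "distinct ps" "\<not> affine_dependent (set ps)"
  shows "distinct (ps @ [z]) \<and> \<not> affine_dependent (set (ps @ [z])) \<longleftrightarrow> z \<notin> affine hull set ps"
  using assms hull_inc[of z "set ps" affine]
  by (auto simp: affine_independent_iff_card aff_dim_insert card_insert_if split: if_splits)

section \<open>Meaning, variables and labels of \<open>H\<close>\<close>

lemma eval_lift_trm [simp]: "eval_trm M (a # e) (lift_trm t) = eval_trm M e t"
  by (induction t) auto

lemma fv_lift_trm [simp]: "fv_trm (lift_trm t) = Suc ` fv_trm t"
  by (induction t) auto

lemma labels_lift_trm [simp]: "labels_trm (lift_trm t) = labels_trm t"
  by (induction t) auto

lemma convex_struct_simps [simp]: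
  "univ (convex_struct K) = K"
  "btw (convex_struct K) a x b \<longleftrightarrow> x \<in> closed_segment a b"
  "comb (convex_struct K) l p q = (1 - l) *\<^sub>R p + l *\<^sub>R q"
  by (simp_all add: convex_struct_def)

text \<open>The recursion of \<open>H\<close> mirrors a fact on hulls: adding a point
  \<open>x\<close> to a nonempty set gives the union of the segments from \<open>x\<close> to the
  points of the old hull.\<close>

lemma sat_H:
  assumes "convex K" "xs \<noteq> []" "\<And>x. x \<in> set xs \<Longrightarrow> eval_trm (convex_struct K) e x \<in> K"
  shows "sat (convex_struct K) e (H z xs) \<longleftrightarrow>
    eval_trm (convex_struct K) e z \<in> convex hull (eval_trm (convex_struct K) e ` set xs)"
  using assms
proof (induction z xs arbitrary: e rule: H.induct)
  case (2 z x y xs)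
  let ?M = "convex_struct K"
  let ?S = "eval_trm ?M e ` set (y # xs)"
  have IH: "sat ?M (a # e) (H (Var 0) (map lift_trm (y # xs))) \<longleftrightarrow> a \<in> convex hull ?S" for a
    by (subst "2.IH") (use "2.prems" in \<open>auto simp: image_image\<close>)
  \<comment> \<open>The quantifier ranges over \<open>K\<close> only; convexity of \<open>K\<close>
    ensures that no point of the hull is lost as a witness.\<close>
  have "convex hull ?S \<subseteq> K"
    using "2.prems" by (intro hull_minimal) auto
  then have "sat ?M e (H z (x # y # xs)) \<longleftrightarrow>
      (\<exists>a\<in>convex hull ?S. eval_trm ?M e z \<in> closed_segment (eval_trm ?M e x) a)"
    using IH by auto
  also have "\<dots> \<longleftrightarrow> eval_trm ?M e z \<in> convex hull (insert (eval_trm ?M e x) ?S)"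
    by (subst convex_hull_insert_segments) auto
  finally show ?case
    by simp
qed auto

lemma fv_H: "xs \<noteq> [] \<Longrightarrow> fv (H z xs) \<subseteq> fv_trm z \<union> \<Union> (fv_trm ` set xs)"
proof (induction z xs rule: H.induct)
  case (2 z x y xs)
  then have "fv (H (Var 0) (map lift_trm (y # xs))) \<subseteq> {0} \<union> Suc ` \<Union> (fv_trm ` set (y # xs))"
    by (simp add: image_Un image_UN)
  then show ?case
    by auto
qed auto

lemma labels_H: "xs \<noteq> [] \<Longrightarrow> labels (H z xs) \<subseteq> labels_trm z \<union> \<Union> (labels_trm ` set xs)"
  by (induction z xs rule: H.induct) auto

section \<open>Meaning, variables and labels of \<open>Dep\<close>\<close>

lemma sat_foldr_Dis: "sat M e (foldr Dis \<phi>s Fls) \<longleftrightarrow> (\<exists>\<phi>\<in>set \<phi>s. sat M e \<phi>)"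
  by (induction \<phi>s) auto

lemma fv_foldr_Dis: "fv (foldr Dis \<phi>s Fls) = \<Union> (fv ` set \<phi>s)"
  by (induction \<phi>s) auto

lemma labels_foldr_Dis: "labels (foldr Dis \<phi>s Fls) = \<Union> (labels ` set \<phi>s)"
  by (induction \<phi>s) auto

text \<open>Serves to show that \<open>Dep\<close> applies \<open>H\<close> to nonempty lists only,
  where \<open>H\<close> is specified.\<close>

lemma nths_eq_Nil_iff: "nths xs I = [] \<longleftrightarrow> I \<inter> {..<length xs} = {}"
  using set_nths[of xs I] by (auto simp flip: set_empty)

lemma set_subseqs_upt: "set (map set (subseqs [0..<m])) = Pow {..<m}"
  using subseqs_powset[of "[0..<m]"] by (simp add: atLeast0LessThan)

lemma set_Dep_disjuncts:
  "set [\<Phi> I. I \<leftarrow> map set (subseqs [0..<m]), I \<noteq> {}, {..<m} - I \<noteq> {}] =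
    \<Phi> ` {I. I \<subseteq> {..<m} \<and> I \<noteq> {} \<and> {..<m} - I \<noteq> {}}"
proof -
  have "set [\<Phi> I. I \<leftarrow> Is, I \<noteq> {}, {..<m} - I \<noteq> {}] =
      \<Phi> ` {I. I \<in> set Is \<and> I \<noteq> {} \<and> {..<m} - I \<noteq> {}}" for Is
    by (induction Is) auto
  then show ?thesis
    unfolding set_subseqs_upt[symmetric] Pow_iff[symmetric] .
qed

text \<open>Each disjunct says that the hulls of two complementary subfamilies meet, so
  \<open>radon_list\<close> applies once the bound \<open>K\<close> on the common point and the
  nonemptiness of the blocks are absorbed.\<close>

lemma sat_Dep:
  fixes K :: "'a::euclidean_space set"
  assumes "convex K" and xs: "\<And>x. x \<in> set xs \<Longrightarrow> eval_trm (convex_struct K) e x \<in> K"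
  defines "ps \<equiv> map (eval_trm (convex_struct K) e) xs"
  shows "sat (convex_struct K) e (Dep xs) \<longleftrightarrow> \<not> (distinct ps \<and> \<not> affine_dependent (set ps))"
proof -
  let ?M = "convex_struct K" and ?m = "length xs"
  have hull: "sat ?M (a # e) (H (Var 0) (map lift_trm (nths xs I))) \<longleftrightarrow> a \<in> convex hull set (nths ps I)"
    if "I \<subseteq> {..<?m}" "I \<noteq> {}" for I a
  proof -
    have "nths xs I \<noteq> []"
      using that by (auto simp: nths_eq_Nil_iff)
    then show ?thesis
      using assms(1) xs by (subst sat_H) (auto simp: image_image ps_def nths_map dest: in_set_nthsD)
  qed
  have "set (nths ps I) \<subseteq> K" for I
    using xs by (auto simp: ps_def dest!: in_set_nthsD)
  then have "convex hull set (nths ps I) \<subseteq> K" for I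
    using assms(1) by (simp add: hull_minimal)
  then have in_hull: "a \<in> K \<and> I \<noteq> {}" if "a \<in> convex hull set (nths ps I)" for a I
    using that by auto
  have "sat ?M e (Dep xs) \<longleftrightarrow> (\<exists>I. I \<subseteq> {..<?m} \<and> I \<noteq> {} \<and> {..<?m} - I \<noteq> {} \<and>
      (\<exists>a\<in>K. a \<in> convex hull set (nths ps I) \<and> a \<in> convex hull set (nths ps ({..<?m} - I))))"
    unfolding Dep_def Let_def sat_foldr_Dis set_Dep_disjuncts
    by (auto simp: hull)
  also have "\<dots> \<longleftrightarrow> (\<exists>I\<subseteq>{..<?m}.
      convex hull set (nths ps I) \<inter> convex hull set (nths ps ({..<?m} - I)) \<noteq> {})"
    by (intro ex_cong1) (use in_hull in blast)
  also have "\<dots> \<longleftrightarrow> \<not> (distinct ps \<and> \<not> affine_dependent (set ps))"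
    using radon_list[of ps] by (simp add: ps_def)
  finally show ?thesis .
qed

lemma fv_Dep: "fv (Dep xs) \<subseteq> \<Union> (fv_trm ` set xs)"
proof -
  \<comment> \<open>Index 0 is the common point of the two hulls; the \<open>Ex\<close> in front
    binds it and undoes the shift of all other indices.\<close>
  have *: "fv (H (Var 0) (map lift_trm (nths xs I))) \<subseteq> {0} \<union> Suc ` \<Union> (fv_trm ` set xs)"
    if "I \<subseteq> {..<length xs}" "I \<noteq> {}" for I
  proof -
    have "nths xs I \<noteq> []"
      using that by (auto simp: nths_eq_Nil_iff)
    then have "fv (H (Var 0) (map lift_trm (nths xs I))) \<subseteq>
        {0} \<union> \<Union> (fv_trm ` set (map lift_trm (nths xs I)))"
      using fv_H[of "map lift_trm (nths xs I)" "Var 0"] by simp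
    also have "\<dots> \<subseteq> {0} \<union> Suc ` \<Union> (fv_trm ` set xs)"
      using set_nths_subset[of xs I] by auto
    finally show ?thesis .
  qed
  have "fv (Ex (Con (H (Var 0) (map lift_trm (nths xs I)))
      (H (Var 0) (map lift_trm (nths xs ({..<length xs} - I)))))) \<subseteq> \<Union> (fv_trm ` set xs)"
    if "I \<subseteq> {..<length xs}" "I \<noteq> {}" "{..<length xs} - I \<noteq> {}" for I
    using *[OF that(1,2)] *[OF Diff_subset that(3)] by auto
  then show ?thesis
    unfolding Dep_def Let_def fv_foldr_Dis set_Dep_disjuncts image_image by (intro UN_least) auto
qed

text \<open>Applied to variables, this makes \<open>Dep\<close> free of function symbols, hence a
  formula of every language, in particular of \<open>L_B\<close>.\<close>

lemma labels_Dep: "labels (Dep xs) \<subseteq> \<Union> (labels_trm ` set xs)"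
proof -
  have *: "labels (H (Var 0) (map lift_trm (nths xs I))) \<subseteq> \<Union> (labels_trm ` set xs)"
    if "I \<subseteq> {..<length xs}" "I \<noteq> {}" for I
  proof -
    have "nths xs I \<noteq> []"
      using that by (auto simp: nths_eq_Nil_iff)
    then have "labels (H (Var 0) (map lift_trm (nths xs I))) \<subseteq>
        \<Union> (labels_trm ` set (map lift_trm (nths xs I)))"
      using labels_H[of "map lift_trm (nths xs I)" "Var 0"] by simp
    also have "\<dots> \<subseteq> \<Union> (labels_trm ` set xs)"
      using set_nths_subset[of xs I] by auto
    finally show ?thesis .
  qed
  have "labels (Ex (Con (H (Var 0) (map lift_trm (nths xs I)))
      (H (Var 0) (map lift_trm (nths xs ({..<length xs} - I)))))) \<subseteq> \<Union> (labels_trm ` set xs)"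
    if "I \<subseteq> {..<length xs}" "I \<noteq> {}" "{..<length xs} - I \<noteq> {}" for I
    using *[OF that(1,2)] *[OF Diff_subset that(3)] by auto
  then show ?thesis
    unfolding Dep_def Let_def labels_foldr_Dis set_Dep_disjuncts image_image by (intro UN_least) auto
qed

section \<open>Relativisation\<close>

text \<open>
  The parameters occupy the end of the environment, so their indices depend on the number \<open>n\<close>
  of variables in front of them; hence \<open>\<delta>\<close> takes this number as an argument.
\<close>

primrec relativise :: "(nat \<Rightarrow> 'l fm) \<Rightarrow> 'l fm \<Rightarrow> nat \<Rightarrow> 'l fm" where
  "relativise \<delta> Fls n = Fls"
| "relativise \<delta> (Eq s t) n = Eq s t"
| "relativise \<delta> (Btw s t u) n = Btw s t u"
| "relativise \<delta> (Neg \<phi>) n = Neg (relativise \<delta> \<phi> n)"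
| "relativise \<delta> (Con \<phi> \<psi>) n = Con (relativise \<delta> \<phi> n) (relativise \<delta> \<psi> n)"
| "relativise \<delta> (Dis \<phi> \<psi>) n = Dis (relativise \<delta> \<phi> n) (relativise \<delta> \<psi> n)"
| "relativise \<delta> (Imp \<phi> \<psi>) n = Imp (relativise \<delta> \<phi> n) (relativise \<delta> \<psi> n)"
| "relativise \<delta> (Ex \<phi>) n = Ex (Con (\<delta> (Suc n)) (relativise \<delta> \<phi> (Suc n)))"
| "relativise \<delta> (All \<phi>) n = All (Imp (\<delta> (Suc n)) (relativise \<delta> \<phi> (Suc n)))"

lemma labels_relativise:
  "(\<And>n. labels (\<delta> n) \<subseteq> L) \<Longrightarrow> labels \<phi> \<subseteq> L \<Longrightarrow> labels (relativise \<delta> \<phi> n) \<subseteq> L"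
  by (induction \<phi> arbitrary: n) auto

lemma subset_lessThan_Suc: "{i. Suc i \<in> S} \<subseteq> {..<n} \<Longrightarrow> S \<subseteq> {..<Suc n}"
proof
  fix i assume "{i. Suc i \<in> S} \<subseteq> {..<n}" "i \<in> S"
  then show "i \<in> {..<Suc n}"
    by (cases i) auto
qed

text \<open>Guards occur only under a quantifier, so always at an index \<open>Suc n\<close>;
  \<open>c\<close> counts the parameters behind the \<open>n\<close> variables.\<close>

lemma fv_relativise:
  assumes "\<And>n. fv (\<delta> (Suc n)) \<subseteq> {..<Suc n + c}"
  shows "fv \<phi> \<subseteq> {..<n} \<Longrightarrow> fv (relativise \<delta> \<phi> n) \<subseteq> {..<n + c}"
proof (induction \<phi> arbitrary: n)
  case (Ex \<phi>)
  have "fv \<phi> \<subseteq> {..<Suc n}"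
    using Ex.prems by (simp add: subset_lessThan_Suc)
  then have "fv (relativise \<delta> \<phi> (Suc n)) \<subseteq> {..<Suc n + c}"
    by (rule Ex.IH)
  then show ?case
    using assms[of n] by auto
next
  case (All \<phi>)
  have "fv \<phi> \<subseteq> {..<Suc n}"
    using All.prems by (simp add: subset_lessThan_Suc)
  then have "fv (relativise \<delta> \<phi> (Suc n)) \<subseteq> {..<Suc n + c}"
    by (rule All.IH)
  then show ?case
    using assms[of n] by auto
qed (fastforce simp: subset_iff)+

text \<open>\<open>N\<close> is a substructure of \<open>M\<close> whose universe is cut out by the
  guard \<delta> with parameters \<open>ps\<close>. The environment holds the new witness, then the
  earlier values \<open>e\<close>, then \<open>ps\<close>, so \<delta> receives
  \<open>Suc (length e)\<close>.\<close>

locale definable_substructure =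
  fixes L :: "'l set" and M N :: "('l, 'a) struct" and ps :: "'a list" and \<delta> :: "nat \<Rightarrow> 'l fm"
  assumes univ_subset: "univ N \<subseteq> univ M"
    and btw_eq: "\<lbrakk>a \<in> univ N; x \<in> univ N; b \<in> univ N\<rbrakk> \<Longrightarrow> btw M a x b = btw N a x b"
    and comb_eq: "\<lbrakk>l \<in> L; a \<in> univ N; b \<in> univ N\<rbrakk> \<Longrightarrow> comb M l a b = comb N l a b"
    and comb_closed: "\<lbrakk>l \<in> L; a \<in> univ N; b \<in> univ N\<rbrakk> \<Longrightarrow> comb N l a b \<in> univ N"
    and sat_delta: "\<lbrakk>a \<in> univ M; set e \<subseteq> univ N\<rbrakk> \<Longrightarrow>
      sat M (a # e @ ps) (\<delta> (Suc (length e))) \<longleftrightarrow> a \<in> univ N"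
begin

lemma eval_trm_substructure:
  assumes "set e \<subseteq> univ N"
  shows "labels_trm t \<subseteq> L \<Longrightarrow> fv_trm t \<subseteq> {..<length e} \<Longrightarrow>
    eval_trm M (e @ ps) t = eval_trm N e t \<and> eval_trm N e t \<in> univ N"
  using assms by (induction t) (auto simp: nth_append comb_eq comb_closed)

text \<open>Atomic formulas agree because terms keep their values and stay in \<open>N\<close>. At a
  quantifier the guard restricts the witnesses from \<open>M\<close> to exactly those in
  \<open>N\<close>.\<close>

lemma sat_relativise:
  "set e \<subseteq> univ N \<Longrightarrow> labels \<phi> \<subseteq> L \<Longrightarrow> fv \<phi> \<subseteq> {..<length e} \<Longrightarrow>
    sat M (e @ ps) (relativise \<delta> \<phi> (length e)) \<longleftrightarrow> sat N e \<phi>"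
proof (induction \<phi> arbitrary: e)
  case (Ex \<phi>)
  have "fv \<phi> \<subseteq> {..<Suc (length e)}"
    using Ex.prems by (simp add: subset_lessThan_Suc)
  then have "sat M ((a # e) @ ps) (relativise \<delta> \<phi> (length (a # e))) \<longleftrightarrow> sat N (a # e) \<phi>"
    if "a \<in> univ N" for a
    using Ex.prems that by (intro Ex.IH) auto
  then show ?case
    using sat_delta Ex.prems(1) univ_subset by fastforce
next
  case (All \<phi>)
  have "fv \<phi> \<subseteq> {..<Suc (length e)}"
    using All.prems by (simp add: subset_lessThan_Suc)
  then have "sat M ((a # e) @ ps) (relativise \<delta> \<phi> (length (a # e))) \<longleftrightarrow> sat N (a # e) \<phi>"
    if "a \<in> univ N" for a
    using All.prems that by (intro All.IH) auto
  then show ?case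
    using sat_delta All.prems(1) univ_subset by fastforce
qed (auto simp: eval_trm_substructure btw_eq)

end

section \<open>Affine identifications\<close>

text \<open>Translating a point of \<open>A\<close> to the origin gives a subspace of the dimension
  of the target; a linear isomorphism after this translation is affine on \<open>A\<close>.\<close>

lemma affine_identification_exists:
  fixes A :: "'a::euclidean_space set"
  assumes "affine A" "aff_dim A = int DIM('b)"
  shows "\<exists>f :: 'a \<Rightarrow> 'b::euclidean_space. affine_identification A f"
proof -
  have "A \<noteq> {}"
    using assms(2) by auto
  then obtain a where a: "a \<in> A"
    by blast
  have "subspace ((\<lambda>x. x - a) ` A)"
    using assms(1) a by (rule affine_diffs_subspace_subtract)
  moreover have "dim ((\<lambda>x. x - a) ` A) = dim (UNIV :: 'b set)"
    using aff_dim_dim_affine_diffs[OF assms(1) a] assms(2) by (simp add: dim_UNIV)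
  ultimately obtain g :: "'a \<Rightarrow> 'b" where g: "linear g" "g ` (\<lambda>x. x - a) ` A = UNIV"
    "inj_on g ((\<lambda>x. x - a) ` A)"
    using subspace_isomorphism[of "(\<lambda>x. x - a) ` A" "UNIV :: 'b set"] by auto
  have "bij_betw (\<lambda>x. g (x - a)) A UNIV"
    using g(2,3) by (auto simp: bij_betw_def inj_on_def image_image)
  moreover have "g ((1 - t) *\<^sub>R x + t *\<^sub>R y - a) = (1 - t) *\<^sub>R g (x - a) + t *\<^sub>R g (y - a)" for x y t
  proof -
    have "(1 - t) *\<^sub>R x + t *\<^sub>R y - a = (1 - t) *\<^sub>R (x - a) + t *\<^sub>R (y - a)"
      by (simp add: algebra_simps)
    then show ?thesis
      using g(1) by (simp add: linear_add linear_scale)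
  qed
  ultimately show ?thesis
    unfolding affine_identification_def by (intro exI[of _ "\<lambda>x. g (x - a)"]) auto
qed

locale affine_iso =
  fixes A :: "'a::real_vector set" and f :: "'a \<Rightarrow> 'b::real_vector"
  assumes aff: "affine A" and ident: "affine_identification A f"
begin

lemma bij: "bij_betw f A UNIV"
  using ident by (simp add: affine_identification_def)

lemma f_line: "x \<in> A \<Longrightarrow> y \<in> A \<Longrightarrow> f ((1 - t) *\<^sub>R x + t *\<^sub>R y) = (1 - t) *\<^sub>R f x + t *\<^sub>R f y"
  using ident by (simp add: affine_identification_def)

lemma line_mem: "x \<in> A \<Longrightarrow> y \<in> A \<Longrightarrow> (1 - t) *\<^sub>R x + t *\<^sub>R y \<in> A"
  by (rule mem_affine[OF aff]) auto

text \<open>Both sides hold with the same parameter \<open>u\<close>. Injectivity is available on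
  \<open>A\<close> only, so points of the line must be known to lie in \<open>A\<close>.\<close>

lemma f_segment_iff:
  assumes "a \<in> A" "x \<in> A" "b \<in> A"
  shows "f x \<in> closed_segment (f a) (f b) \<longleftrightarrow> x \<in> closed_segment a b"
proof -
  have "f x = (1 - u) *\<^sub>R f a + u *\<^sub>R f b \<longleftrightarrow> x = (1 - u) *\<^sub>R a + u *\<^sub>R b" for u
    using assms bij_betw_imp_inj_on[OF bij] by (metis f_line inj_on_eq_iff line_mem)
  then show ?thesis
    by (simp add: in_segment)
qed

lemma convex_image:
  assumes "S \<subseteq> A" "convex S"
  shows "convex (f ` S)"
  unfolding convex_alt
proof clarify
  fix x y and u :: real
  assume "x \<in> S" "y \<in> S" "0 \<le> u" "u \<le> 1"
  then have "(1 - u) *\<^sub>R x + u *\<^sub>R y \<in> S"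
    using assms(2) by (simp add: convex_alt)
  moreover have "(1 - u) *\<^sub>R f x + u *\<^sub>R f y = f ((1 - u) *\<^sub>R x + u *\<^sub>R y)"
    using \<open>x \<in> S\<close> \<open>y \<in> S\<close> assms(1) f_line by (metis subsetD)
  ultimately show "(1 - u) *\<^sub>R f x + u *\<^sub>R f y \<in> f ` S"
    by simp
qed

lemma affine_preimage:
  assumes "affine T"
  shows "affine {x \<in> A. f x \<in> T}"
  unfolding affine_alt using assms by (auto simp: f_line line_mem affine_alt)

text \<open>The preimage of the hull of the image is an affine set containing \<open>S\<close>,
  hence all of \<open>A\<close>, and \<open>f\<close> maps \<open>A\<close> onto the whole
  space.\<close>

lemma affine_hull_image:
  assumes "S \<subseteq> A" "affine hull S = A"
  shows "affine hull (f ` S) = UNIV"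
proof -
  have "S \<subseteq> {x \<in> A. f x \<in> affine hull (f ` S)}"
    using assms(1) by (auto intro: hull_inc)
  then have "A \<subseteq> {x \<in> A. f x \<in> affine hull (f ` S)}"
    using affine_preimage[OF affine_affine_hull] by (subst assms(2)[symmetric]) (rule hull_minimal)
  then have "f ` A \<subseteq> affine hull (f ` S)"
    by auto
  then show ?thesis
    using bij_betw_imp_surj_on[OF bij] by auto
qed

lemma struct_iso_image:
  assumes "S \<subseteq> A"
  shows "struct_iso L (convex_struct S) (convex_struct (f ` S)) f"
proof -
  have "bij_betw f S (f ` S)"
    using bij_betw_imp_inj_on[OF bij] assms by (simp add: bij_betw_def inj_on_subset)
  then show ?thesis
    using assms by (auto simp: struct_iso_def f_segment_iff f_line subset_iff)
qed

end

text \<open>A nonempty convex set has a relative interior point, and the image spans the whole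
  space, where relative interior and interior coincide.\<close>

lemma interior_image_nonempty:
  fixes f :: "'a::real_vector \<Rightarrow> 'b::euclidean_space"
  assumes "affine_iso A f" "S \<subseteq> A" "convex S" "affine hull S = A"
  shows "interior (f ` S) \<noteq> {}"
proof -
  have *: "affine hull (f ` S) = UNIV"
    using assms by (simp add: affine_iso.affine_hull_image)
  then have "f ` S \<noteq> {}"
    by force
  then have "rel_interior (f ` S) \<noteq> {}"
    using assms by (subst rel_interior_eq_empty) (auto intro: affine_iso.convex_image)
  then show ?thesis
    using rel_interior_interior[OF *] by simp
qed

section \<open>Plane sections\<close>

locale plane_section =
  fixes K :: "'a::euclidean_space set" and p1 p2 p3 :: 'a
  assumes cvx: "convex K" and p_in: "p1 \<in> K" "p2 \<in> K" "p3 \<in> K"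
    and noncollinear: "\<not> collinear {p1, p2, p3}"
begin

abbreviation "A \<equiv> affine hull {p1, p2, p3}"

lemma indep: "distinct [p1, p2, p3]" "\<not> affine_dependent {p1, p2, p3}"
  using noncollinear by (auto simp: collinear_3_eq_affine_dependent)

lemma aff_dim_A: "aff_dim A = 2"
  using indep by (simp add: affine_independent_iff_card)

text \<open>Since the first three points are independent, dependence of all four puts
  \<open>z\<close> in their hull. Arbitrary terms serve both the defining formula and the guards,
  whose variables sit at different indices.\<close>

lemma sat_Dep_section:
  assumes "eval_trm (convex_struct K) e s1 = p1" "eval_trm (convex_struct K) e s2 = p2"
    "eval_trm (convex_struct K) e s3 = p3" "eval_trm (convex_struct K) e t = z" "z \<in> K"
  shows "sat (convex_struct K) e (Dep [s1, s2, s3, t]) \<longleftrightarrow> z \<in> A"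
proof -
  have "sat (convex_struct K) e (Dep [s1, s2, s3, t]) \<longleftrightarrow>
      \<not> (distinct [p1, p2, p3, z] \<and> \<not> affine_dependent (set [p1, p2, p3, z]))"
    using assms p_in by (subst sat_Dep[OF cvx]) auto
  also have "\<dots> \<longleftrightarrow> z \<in> A"
    using distinct_affine_independent_insert_iff[of "[p1, p2, p3]" z] indep by simp
  finally show ?thesis .
qed

lemma definable_section:
  "definable_with_params L (convex_struct K) [p1, p2, p3] (K \<inter> A)"
proof -
  let ?D = "Dep [Var 0, Var 1, Var 2, Var 3] :: real fm"
  have "?D \<in> formulas L"
    using labels_Dep[of "[Var 0, Var 1, Var 2, Var 3] :: real trm list"] by (auto simp: formulas_def)
  moreover have "fv ?D \<subseteq> {..<length [p1, p2, p3] + 1}"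
    using fv_Dep[of "[Var 0, Var 1, Var 2, Var 3] :: real trm list"] by auto
  moreover have "K \<inter> A = {z \<in> univ (convex_struct K). sat (convex_struct K) ([p1, p2, p3] @ [z]) ?D}"
    by (auto simp: sat_Dep_section numeral_3_eq_3)
  ultimately show ?thesis
    using p_in by (auto simp: definable_with_params_def)
qed

lemma convex_section: "convex (K \<inter> A)"
  by (simp add: cvx convex_Int affine_imp_convex)

lemma affine_hull_section: "affine hull (K \<inter> A) = A"
proof
  show "affine hull (K \<inter> A) \<subseteq> A"
    by (simp add: hull_minimal)
  show "A \<subseteq> affine hull (K \<inter> A)"
    using p_in by (intro hull_mono) (auto simp: hull_inc)
qed

lemma comb_section:
  "l \<in> {0..1} \<Longrightarrow> p \<in> K \<inter> A \<Longrightarrow> q \<in> K \<inter> A \<Longrightarrow> comb (convex_struct K) l p q \<in> K \<inter> A"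
  using convex_section unfolding convex_alt by auto

text \<open>The parameters follow the first \<open>n\<close> entries of the environment; the point
  tested is the innermost bound variable, of index 0.\<close>

definition \<delta> :: "nat \<Rightarrow> real fm" where
  "\<delta> n = Dep [Var n, Var (n + 1), Var (n + 2), Var 0]"

lemma labels_delta: "labels (\<delta> n) \<subseteq> L"
  using labels_Dep[of "[Var n, Var (n + 1), Var (n + 2), Var 0] :: real trm list"]
  by (auto simp: \<delta>_def)

lemma fv_delta: "fv (\<delta> (Suc n)) \<subseteq> {..<Suc n + 3}"
  using fv_Dep[of "[Var (Suc n), Var (Suc n + 1), Var (Suc n + 2), Var 0] :: real trm list"]
  by (auto simp: \<delta>_def)

text \<open>Labels in the unit interval make the operations convex combinations, so they preserve
  the section.\<close>

lemma definable_substructure_section: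
  assumes "L \<subseteq> {0..1}"
  shows "definable_substructure L (convex_struct K) (convex_struct (K \<inter> A)) [p1, p2, p3] \<delta>"
proof
  fix a e assume "a \<in> univ (convex_struct K)"
  then show "sat (convex_struct K) (a # e @ [p1, p2, p3]) (\<delta> (Suc (length e))) \<longleftrightarrow>
      a \<in> univ (convex_struct (K \<inter> A))"
    by (simp add: \<delta>_def sat_Dep_section nth_append)
qed (use assms comb_section in auto)

lemma transfer_formula:
  assumes "L \<subseteq> {0..1}" "\<phi> \<in> formulas L" "fv \<phi> \<subseteq> {..<k}"
  shows "\<exists>\<psi>\<in>formulas L. fv \<psi> \<subseteq> {..<k + 3} \<and>
    (\<forall>as. length as = k \<and> set as \<subseteq> K \<inter> A \<longrightarrow>
      (sat (convex_struct K) (as @ [p1, p2, p3]) \<psi> \<longleftrightarrow> sat (convex_struct (K \<inter> A)) as \<phi>))"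
proof (intro bexI[of _ "relativise \<delta> \<phi> k"] conjI allI impI)
  show "relativise \<delta> \<phi> k \<in> formulas L"
    using assms(2) labels_relativise[OF labels_delta] by (simp add: formulas_def)
  show "fv (relativise \<delta> \<phi> k) \<subseteq> {..<k + 3}"
    using fv_delta assms(3) by (rule fv_relativise)
  fix as assume "length as = k \<and> set as \<subseteq> K \<inter> A"
  then show "sat (convex_struct K) (as @ [p1, p2, p3]) (relativise \<delta> \<phi> k) \<longleftrightarrow>
      sat (convex_struct (K \<inter> A)) as \<phi>"
    using definable_substructure.sat_relativise[OF definable_substructure_section[OF assms(1)], of as \<phi>]
      assms(2,3) by (auto simp: formulas_def)
qed

end

theorem proposition4p8:
  fixes K A :: "(real ^ 'n) set" and p1 p2 p3 :: "real ^ 'n"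
  assumes "CARD('n) \<ge> 2"
    and "convex K"
    and "p1 \<in> K" "p2 \<in> K" "p3 \<in> K"
    and "\<not> collinear {p1, p2, p3}"
    and A: "A = affine hull {p1, p2, p3}"
  shows
    "(affine A \<and> aff_dim A = 2)
     \<and>
     (K \<inter> A = {z \<in> K. sat (convex_struct K) [p1, p2, p3, z] (Dep [Var 0, Var 1, Var 2, Var 3])}
       \<and> definable_with_params L_B (convex_struct K) [p1, p2, p3] (K \<inter> A))
     \<and>
     (convex (K \<inter> A)
       \<and> (\<forall>l \<in> {0..1}. \<forall>p \<in> K \<inter> A. \<forall>q \<in> K \<inter> A. comb (convex_struct K) l p q \<in> K \<inter> A)
       \<and> rel_interior (K \<inter> A) \<noteq> {}
       \<and> (compact K \<longrightarrow> compact (K \<inter> A))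
       \<and> (\<exists>f :: real ^ 'n \<Rightarrow> real ^ 2. affine_identification A f)
       \<and> (\<forall>f :: real ^ 'n \<Rightarrow> real ^ 2. affine_identification A f \<longrightarrow>
            convex (f ` (K \<inter> A))
            \<and> interior (f ` (K \<inter> A)) \<noteq> {}
            \<and> struct_iso L_B (convex_struct (K \<inter> A)) (convex_struct (f ` (K \<inter> A))) f
            \<and> struct_iso L_aff (convex_struct (K \<inter> A)) (convex_struct (f ` (K \<inter> A))) f))
     \<and>
     (\<forall>L \<in> {L_B, L_aff}. \<forall>k. \<forall>\<phi> \<in> formulas L. fv \<phi> \<subseteq> {..<k} \<longrightarrow>
       (\<exists>\<psi> \<in> formulas L. fv \<psi> \<subseteq> {..<k + 3} \<and>
         (\<forall>as. length as = k \<and> set as \<subseteq> K \<inter> A \<longrightarrow>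
           (sat (convex_struct K) (as @ [p1, p2, p3]) \<psi> \<longleftrightarrow>
            sat (convex_struct (K \<inter> A)) as \<phi>))))"
proof -
  interpret plane_section K p1 p2 p3
    using assms(2-6) by unfold_locales
  have iso: "affine_iso A f" if "affine_identification A f" for f :: "real ^ 'n \<Rightarrow> real ^ 2"
    using that by unfold_locales (simp_all add: A)
  have "K \<inter> A = {z \<in> K. sat (convex_struct K) [p1, p2, p3, z] (Dep [Var 0, Var 1, Var 2, Var 3])}"
    by (auto simp: A sat_Dep_section numeral_3_eq_3)
  \<comment> \<open>The section is convex and contains \<open>p1\<close>.\<close>
  moreover have "rel_interior (K \<inter> A) \<noteq> {}"
    using p_in convex_section by (subst rel_interior_eq_empty) (auto simp: A hull_inc)
  moreover have "compact (K \<inter> A)" if "compact K"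
    using that by (simp add: A compact_Int_closed closed_affine_hull)
  moreover have "\<exists>f :: real ^ 'n \<Rightarrow> real ^ 2. affine_identification A f"
    using aff_dim_A by (intro affine_identification_exists) (simp_all add: A)
  moreover have "interior (f ` (K \<inter> A)) \<noteq> {}" "convex (f ` (K \<inter> A))"
    "struct_iso L (convex_struct (K \<inter> A)) (convex_struct (f ` (K \<inter> A))) f"
    if "affine_identification A f" for f :: "real ^ 'n \<Rightarrow> real ^ 2" and L
    using interior_image_nonempty[OF iso[OF that], of "K \<inter> A"] iso[OF that]
      convex_section affine_hull_section
    by (simp_all add: A affine_iso.convex_image affine_iso.struct_iso_image)
  \<comment> \<open>This admits both languages to \<open>transfer_formula\<close>;
    \<open>L_B\<close> has no labels at all.\<close>
  moreover have "L \<subseteq> {0..1}" if "L \<in> {L_B, L_aff}" for L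
    using that by (auto simp: L_B_def L_aff_def)
  ultimately show ?thesis
    using aff_dim_A definable_section convex_section comb_section transfer_formula
    unfolding A by (intro conjI ballI allI impI) (auto simp del: convex_struct_simps)
qed

end
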